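(* For every integer $n\geq 2$, the projective closure in $\mathbb{P}^1$ of the affine $\delta$-variety in $\mathbb{A}^1$ defined by $x''=x^{n}$ is not $\delta$-complete.
   Context: All differential fields have characteristic zero and a single derivation $\delta$ (written $x'$, $x''$). $\mathcal{F}$ is a fixed arbitrary differentially closed field of characteristic zero (a model of $DCF_0$), contained in a large saturated model $\mathcal{U}$ of $DCF_0$. $\mathbb{P}^n$ and $\mathbb{A}^m$ mean $\mathbb{P}^n(\mathcal{U})$ and $\mathbb{A}^m(\mathcal{U})$. A $\delta$-polynomial $g(x_0,\dots,x_k)$ is $\delta$-homogeneous if there is a natural number $d$ with $g(\lambda\bar x)=\lambda^d g(\bar x)$ for all nonzero $\lambda$ in the ground $\delta$-field. $\delta$-varieties (Kolchin-closed subsets) in affine, resp. projective, space are the zero loci, in $\mathcal{U}$-points, of sets of $\delta$-polynomials, resp. $\delta$-homogeneous $\delta$-polynomials, with coefficients in $\mathcal{F}$; Kolchin-closed subsets of a product with projective factors are defined by $\delta$-polynomials over $\mathcal{F}$ that are $\delta$-homogeneous in each group of projective coordinates. The projective closure of an affine $\delta$-variety $X\subseteq\mathbb{A}^1$ (embedded in $\mathbb{P}^1$ by $x\mapsto(x:1)$) is the intersection of all projective $\delta$-varieties in $\mathbb{P}^1$ containing it. A projective $\delta$-variety $V$ is $\delta$-complete if for every projective $\delta$-variety $W$ over $\mathcal{F}$ and every Kolchin-closed $Z\subseteq V\times W$, the image $\pi_2(Z)\subseteq W$ under the second projection is Kolchin-closed (equivalently, one may take $W=\mathbb{A}^m$,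 $m$ arbitrary). *)

theory Defs
  imports "HOL-Library.Poly_Mapping"
begin

section \<open>Differential fields and differential polynomials\<close>

text \<open>The universe is a field of characteristic zero (the whole type) with a derivation \<open>\<delta>\<close>; differential subfields
  are subsets of it.\<close>

definition derivation :: "('u::field_char_0 \<Rightarrow> 'u) \<Rightarrow> bool" where
  "derivation \<delta> \<longleftrightarrow>
     (\<forall>x y. \<delta> (x + y) = \<delta> x + \<delta> y) \<and> (\<forall>x y. \<delta> (x * y) = \<delta> x * y + x * \<delta> y)"

definition delta_subfield :: "('u::field_char_0 \<Rightarrow> 'u) \<Rightarrow> 'u set \<Rightarrow> bool" where
  "delta_subfield \<delta> F \<longleftrightarrow>
     0 \<in> F \<and> 1 \<in> F \<and>
     (\<forall>x\<in>F. \<forall>y\<in>F. x + y \<in> F \<and> x * y \<in> F) \<and>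
     (\<forall>x\<in>F. - x \<in> F \<and> inverse x \<in> F \<and> \<delta> x \<in> F)"

text \<open>A differential polynomial in variables \<open>x\<^sub>v\<close>, with \<open>v\<close> ranging over \<open>'v\<close>, is an ordinary
  polynomial in the indeterminates \<open>(v, k)\<close>, where \<open>(v, k)\<close> stands for the \<open>k\<close>-th derivative
  of \<open>x\<^sub>v\<close>.\<close>

type_synonym ('v, 'u) dpoly = "('v \<times> nat \<Rightarrow>\<^sub>0 nat) \<Rightarrow>\<^sub>0 'u"

definition dvars :: "('v, 'u::field_char_0) dpoly \<Rightarrow> ('v \<times> nat) set" where
  "dvars g = (\<Union>m\<in>Poly_Mapping.keys g. Poly_Mapping.keys m)"

definition dpoly_over :: "'u::field_char_0 set \<Rightarrow> 'v set \<Rightarrow> ('v, 'u) dpoly \<Rightarrow> bool" where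
  "dpoly_over F I g \<longleftrightarrow>
     (\<forall>m. Poly_Mapping.lookup g m \<in> F) \<and> fst ` dvars g \<subseteq> I"

definition deval ::
  "('u::field_char_0 \<Rightarrow> 'u) \<Rightarrow> ('v, 'u) dpoly \<Rightarrow> ('v \<Rightarrow> 'u) \<Rightarrow> 'u" where
  "deval \<delta> g x =
     (\<Sum>m\<in>Poly_Mapping.keys g. Poly_Mapping.lookup g m *
        (\<Prod>(v, k)\<in>Poly_Mapping.keys m. (\<delta> ^^ k) (x v) ^ Poly_Mapping.lookup m (v, k)))"

section \<open>Models of \<open>DCF\<^sub>0\<close> and saturation\<close>

text \<open>Constants (including 0) have order \<open>-1\<close>.\<close>

definition dorder :: "(unit, 'u::field_char_0) dpoly \<Rightarrow> int" where
  "dorder g = (if dvars g = {} then -1 else int (Max (snd ` dvars g)))"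

text \<open>Blum's axioms.  With \<open>g = 1\<close> and \<open>f\<close> of order 0 they include algebraic closedness.\<close>

definition differentially_closed :: "('u::field_char_0 \<Rightarrow> 'u) \<Rightarrow> 'u set \<Rightarrow> bool" where
  "differentially_closed \<delta> K \<longleftrightarrow>
     (\<forall>f g. dpoly_over K UNIV f \<and> dpoly_over K UNIV g \<and> g \<noteq> 0 \<and> dorder g < dorder f \<longrightarrow>
        (\<exists>a\<in>K. deval \<delta> f (\<lambda>_. a) = 0 \<and> deval \<delta> g (\<lambda>_. a) \<noteq> 0))"

definition model_DCF0 :: "('u::field_char_0 \<Rightarrow> 'u) \<Rightarrow> 'u set \<Rightarrow> bool" where
  "model_DCF0 \<delta> K \<longleftrightarrow> delta_subfield \<delta> K \<and> differentially_closed \<delta> K"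

text \<open>First-order formulas in the language of differential rings, with parameters.\<close>

datatype (tparams: 'u) dterm =
    TVar nat | TParam 'u | TZero | TOne
  | TAdd "'u dterm" "'u dterm" | TNeg "'u dterm" | TMul "'u dterm" "'u dterm"
  | TDer "'u dterm"

datatype (fparams: 'u) dform =
    FEq "'u dterm" "'u dterm" | FNot "'u dform" | FAnd "'u dform" "'u dform"
  | FEx nat "'u dform"

primrec tvars :: "'u dterm \<Rightarrow> nat set" where
  "tvars (TVar i) = {i}"
| "tvars (TParam c) = {}"
| "tvars TZero = {}"
| "tvars TOne = {}"
| "tvars (TAdd s t) = tvars s \<union> tvars t"
| "tvars (TNeg t) = tvars t"
| "tvars (TMul s t) = tvars s \<union> tvars t"
| "tvars (TDer t) = tvars t"

primrec free_vars :: "'u dform \<Rightarrow> nat set" where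
  "free_vars (FEq s t) = tvars s \<union> tvars t"
| "free_vars (FNot \<phi>) = free_vars \<phi>"
| "free_vars (FAnd \<phi> \<psi>) = free_vars \<phi> \<union> free_vars \<psi>"
| "free_vars (FEx i \<phi>) = free_vars \<phi> - {i}"

primrec tval :: "('u::field_char_0 \<Rightarrow> 'u) \<Rightarrow> (nat \<Rightarrow> 'u) \<Rightarrow> 'u dterm \<Rightarrow> 'u" where
  "tval \<delta> e (TVar i) = e i"
| "tval \<delta> e (TParam c) = c"
| "tval \<delta> e TZero = 0"
| "tval \<delta> e TOne = 1"
| "tval \<delta> e (TAdd s t) = tval \<delta> e s + tval \<delta> e t"
| "tval \<delta> e (TNeg t) = - tval \<delta> e t"
| "tval \<delta> e (TMul s t) = tval \<delta> e s * tval \<delta> e t"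
| "tval \<delta> e (TDer t) = \<delta> (tval \<delta> e t)"

primrec holds :: "('u::field_char_0 \<Rightarrow> 'u) \<Rightarrow> (nat \<Rightarrow> 'u) \<Rightarrow> 'u dform \<Rightarrow> bool" where
  "holds \<delta> e (FEq s t) \<longleftrightarrow> tval \<delta> e s = tval \<delta> e t"
| "holds \<delta> e (FNot \<phi>) \<longleftrightarrow> \<not> holds \<delta> e \<phi>"
| "holds \<delta> e (FAnd \<phi> \<psi>) \<longleftrightarrow> holds \<delta> e \<phi> \<and> holds \<delta> e \<psi>"
| "holds \<delta> e (FEx i \<phi>) \<longleftrightarrow> (\<exists>a. holds \<delta> (e(i := a)) \<phi>)"

definition fewer_than_universe :: "'u set \<Rightarrow> bool" where
  "fewer_than_universe A \<longleftrightarrow> (card_of A, card_of (UNIV :: 'u set)) \<in> ordLess"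

text \<open>Every finitely satisfiable set of formulas in the variable 0 with parameters from a set
  of cardinality less than that of the universe is realized.\<close>

definition saturated :: "('u::field_char_0 \<Rightarrow> 'u) \<Rightarrow> bool" where
  "saturated \<delta> \<longleftrightarrow>
     (\<forall>A \<Phi>. fewer_than_universe A \<and>
        (\<forall>\<phi>\<in>\<Phi>. fparams \<phi> \<subseteq> A \<and> free_vars \<phi> \<subseteq> {0}) \<and>
        (\<forall>\<Psi>. finite \<Psi> \<and> \<Psi> \<subseteq> \<Phi> \<longrightarrow> (\<exists>a. \<forall>\<phi>\<in>\<Psi>. holds \<delta> (\<lambda>_. a) \<phi>)) \<longrightarrow>
        (\<exists>a. \<forall>\<phi>\<in>\<Phi>. holds \<delta> (\<lambda>_. a) \<phi>))"

section \<open>Projective Kolchin-closed sets\<close>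

text \<open>\<open>G\<close> is the group of coordinates that is scaled.  The identity is required for all values of
  the variables in the universe; over a differentially closed field this is the same as an
  identity of differential polynomials.\<close>

definition dhomogeneous ::
  "('u::field_char_0 \<Rightarrow> 'u) \<Rightarrow> 'u set \<Rightarrow> 'v set \<Rightarrow> ('v, 'u) dpoly \<Rightarrow> bool" where
  "dhomogeneous \<delta> F G g \<longleftrightarrow>
     (\<exists>d::nat. \<forall>c\<in>F - {0}. \<forall>x.
        deval \<delta> g (\<lambda>v. if v \<in> G then c * x v else x v) = c ^ d * deval \<delta> g x)"

text \<open>A point of projective \<open>n\<close>-space is the set of its homogeneous coordinate vectors; the
  coordinates are indexed by \<open>0, \<dots>, n\<close> and padded with zeros.\<close>

definition proj_point :: "(nat \<Rightarrow> 'u::field_char_0) \<Rightarrow> (nat \<Rightarrow> 'u) set" where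
  "proj_point x = {\<lambda>i. c * x i |c. c \<noteq> 0}"

definition proj_space :: "nat \<Rightarrow> (nat \<Rightarrow> 'u::field_char_0) set set" where
  "proj_space n = {proj_point x |x. (\<exists>i\<le>n. x i \<noteq> 0) \<and> (\<forall>i>n. x i = 0)}"

definition proj_variety ::
  "('u::field_char_0 \<Rightarrow> 'u) \<Rightarrow> 'u set \<Rightarrow> nat \<Rightarrow> (nat \<Rightarrow> 'u) set set \<Rightarrow> bool" where
  "proj_variety \<delta> F n V \<longleftrightarrow>
     (\<exists>S :: (nat, 'u) dpoly set.
        (\<forall>g\<in>S. dpoly_over F {..n} g \<and> dhomogeneous \<delta> F {..n} g) \<and>
        V = {p \<in> proj_space n. \<forall>x\<in>p. \<forall>g\<in>S. deval \<delta> g x = 0})"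

text \<open>In a product of two projective spaces the coordinates of the factors are the variables
  \<open>Inl i\<close> and \<open>Inr j\<close>.\<close>

definition closed_in_product ::
  "('u::field_char_0 \<Rightarrow> 'u) \<Rightarrow> 'u set \<Rightarrow> nat \<Rightarrow> nat \<Rightarrow>
     ((nat \<Rightarrow> 'u) set \<times> (nat \<Rightarrow> 'u) set) set \<Rightarrow> bool" where
  "closed_in_product \<delta> F n m Z \<longleftrightarrow>
     (\<exists>S :: (nat + nat, 'u) dpoly set.
        (\<forall>g\<in>S. dpoly_over F (Inl ` {..n} \<union> Inr ` {..m}) g \<and>
           dhomogeneous \<delta> F (Inl ` {..n}) g \<and> dhomogeneous \<delta> F (Inr ` {..m}) g) \<and>
        Z = {(p, q) \<in> proj_space n \<times> proj_space m.
               \<forall>x\<in>p. \<forall>y\<in>q. \<forall>g\<in>S. deval \<delta> g (case_sum x y) = 0})"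

text \<open>For \<open>V\<close> a projective variety in projective \<open>n\<close>-space.\<close>

definition delta_complete ::
  "('u::field_char_0 \<Rightarrow> 'u) \<Rightarrow> 'u set \<Rightarrow> nat \<Rightarrow> (nat \<Rightarrow> 'u) set set \<Rightarrow> bool" where
  "delta_complete \<delta> F n V \<longleftrightarrow>
     (\<forall>m W Z. proj_variety \<delta> F m W \<and> Z \<subseteq> V \<times> W \<and> closed_in_product \<delta> F n m Z \<longrightarrow>
        proj_variety \<delta> F m (snd ` Z))"

text \<open>The embedding \<open>x \<mapsto> (x : 1)\<close> of the affine line, and the closure with respect to it.\<close>

definition affine_point :: "'u::field_char_0 \<Rightarrow> (nat \<Rightarrow> 'u) set" where
  "affine_point x = proj_point (\<lambda>i. if i = 0 then x else if i = 1 then 1 else 0)"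

definition projective_closure ::
  "('u::field_char_0 \<Rightarrow> 'u) \<Rightarrow> 'u set \<Rightarrow> 'u set \<Rightarrow> (nat \<Rightarrow> 'u) set set" where
  "projective_closure \<delta> F X = \<Inter> {V. proj_variety \<delta> F 1 V \<and> affine_point ` X \<subseteq> V}"

lemma proj_variety_projective_closure:
  fixes \<delta> :: "'u::field_char_0 \<Rightarrow> 'u"
  shows "proj_variety \<delta> F 1 (projective_closure \<delta> F X)"
proof -
  define good where "good g \<longleftrightarrow> dpoly_over F {..1::nat} g \<and> dhomogeneous \<delta> F {..1} g"
    for g :: "(nat, 'u) dpoly"
  define zl where "zl S = {p \<in> proj_space 1. \<forall>x\<in>p. \<forall>g\<in>S. deval \<delta> g x = 0}"
    for S :: "(nat, 'u) dpoly set"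
  have pv: "proj_variety \<delta> F 1 V \<longleftrightarrow> (\<exists>S. (\<forall>g\<in>S. good g) \<and> V = zl S)" for V
    unfolding proj_variety_def good_def zl_def by blast
  define T where "T = \<Union>{S. (\<forall>g\<in>S. good g) \<and> affine_point ` X \<subseteq> zl S}"
  have aff: "affine_point ` X \<subseteq> proj_space 1"
  proof
    fix p assume "p \<in> affine_point ` X"
    then obtain a where p: "p = affine_point a" by blast
    show "p \<in> proj_space 1"
      unfolding p affine_point_def proj_space_def mem_Collect_eq
      by (rule exI, rule conjI, rule refl) (auto intro: exI[of _ 1])
  qed
  then have e: "affine_point ` X \<subseteq> zl {}" unfolding zl_def by auto
  have "projective_closure \<delta> F X = \<Inter> {zl S |S. (\<forall>g\<in>S. good g) \<and> affine_point ` X \<subseteq> zl S}"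
    unfolding projective_closure_def pv by (rule arg_cong[where f = Inter]) blast
  also have "\<dots> = zl T"
  proof
    show "\<Inter> {zl S |S. (\<forall>g\<in>S. good g) \<and> affine_point ` X \<subseteq> zl S} \<subseteq> zl T"
    proof
      fix p assume p: "p \<in> \<Inter> {zl S |S. (\<forall>g\<in>S. good g) \<and> affine_point ` X \<subseteq> zl S}"
      then have "p \<in> zl {}" using e by blast
      then have "p \<in> proj_space 1" by (simp add: zl_def)
      moreover have "deval \<delta> g x = 0" if "x \<in> p" "g \<in> T" for x g
      proof -
        from \<open>g \<in> T\<close> obtain S where "\<forall>g\<in>S. good g" "affine_point ` X \<subseteq> zl S" "g \<in> S"
          unfolding T_def by blast
        with p have "p \<in> zl S" by blast
        with \<open>x \<in> p\<close> \<open>g \<in> S\<close> show ?thesis by (simp add: zl_def)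
      qed
      ultimately show "p \<in> zl T" by (simp add: zl_def)
    qed
    show "zl T \<subseteq> \<Inter> {zl S |S. (\<forall>g\<in>S. good g) \<and> affine_point ` X \<subseteq> zl S}"
      unfolding T_def zl_def by blast
  qed
  finally have "projective_closure \<delta> F X = zl T" .
  moreover have "\<forall>g\<in>T. good g" unfolding T_def by blast
  ultimately show ?thesis unfolding pv by blast
qed

end

theory Submission
  imports Defs "HOL-Computational_Algebra.Polynomial"
begin

text \<open>
  On the solutions of \<open>x'' = x\<^sup>n\<close> the energy \<open>e(x) = (n + 1) x'\<^sup>2 - 2 x\<^sup>n\<^sup>+\<^sup>1\<close> is constant. Consider the
  pairs \<open>(x, t)\<close>, with \<open>x\<close> a solution and \<open>t\<close> in the projective line, such that \<open>t e(x) = 1\<close>. They form a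
  kind of hyperbola: no pair has \<open>t = 0\<close>. On the other hand every positive integer \<open>t\<close> occurs,
  because over a differentially closed field the first-order equation \<open>e(x) = 1 / t\<close> has a solution
  with \<open>x' \<noteq> 0\<close>, and differentiating that equation and cancelling \<open>x'\<close> gives \<open>x'' = x\<^sup>n\<close>
  (\<open>ex_solution_with_energy\<close>). A differential polynomial in \<open>t\<close> restricts to an ordinary polynomial
  on the constants, so if it vanishes at all positive integers it also vanishes at \<open>0\<close>
  (\<open>deval_vanishes_at_limit_of_constants\<close>). Hence the set of all \<open>t\<close> that occur is not Kolchin-closed.

  It remains to see that the set of pairs is closed in the product of two projective lines. Here
  the danger is the point at infinity of the first line: after denominators are cleared, the
  relation \<open>t e(x) = 1\<close> may hold at infinity for \<open>t = 0\<close>. So infinity must be removed by a closed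
  condition, that is, by a \<open>\<delta>\<close>-homogeneous polynomial that vanishes on all solutions but not at
  infinity (\<open>ex_hom_dpoly_separating_infinity\<close>). For \<open>n \<ge> 3\<close> the homogenised equation itself does
  this. For \<open>n = 2\<close> it does not, and one uses a third-order consequence of the equation satisfied by
  \<open>u = 1 / x\<close>. The resulting set of pairs (\<open>energy_correspondence\<close>) lies over solutions only, hence
  over the projective closure.
\<close>


section \<open>Derivations\<close>

context
  fixes \<delta> :: "'u::field_char_0 \<Rightarrow> 'u"
  assumes der: "derivation \<delta>"
begin

lemma derivation_add: "\<delta> (x + y) = \<delta> x + \<delta> y"
  and derivation_mult: "\<delta> (x * y) = \<delta> x * y + x * \<delta> y"
  using der by (auto simp: derivation_def)

lemma derivation_0: "\<delta> 0 = 0"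
  using derivation_add[of 0 0] by simp

lemma derivation_1: "\<delta> 1 = 0"
  using derivation_mult[of 1 1] by simp

lemma derivation_minus: "\<delta> (- x) = - \<delta> x"
  using derivation_add[of x "- x"] by (simp add: derivation_0 minus_unique)

lemma derivation_diff: "\<delta> (x - y) = \<delta> x - \<delta> y"
  using derivation_add[of x "- y"] by (simp add: derivation_minus)

lemma derivation_of_nat: "\<delta> (of_nat m) = 0"
  by (induction m) (simp_all add: derivation_0 derivation_1 derivation_add)

lemma derivation_numeral: "\<delta> (numeral m) = 0"
  using derivation_of_nat[of "numeral m"] by simp

lemma derivation_power: "\<delta> (x ^ m) = of_nat m * x ^ (m - 1) * \<delta> x"
proof (induction m)
  case (Suc m)
  then show ?case
    by (cases m) (simp_all add: derivation_mult algebra_simps)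
qed (simp add: derivation_1)

lemma derivation_sum: "\<delta> (sum f A) = (\<Sum>a\<in>A. \<delta> (f a))"
  by (induction A rule: infinite_finite_induct) (simp_all add: derivation_0 derivation_add)

lemma derivation_iterate_0: "(\<delta> ^^ k) 0 = 0"
  by (induction k) (simp_all add: derivation_0)

text \<open>Linearity over the constants is what makes a differential polynomial an ordinary one on
  constant arguments.\<close>
lemma derivation_iterate_constant_mult: "(\<delta> ^^ k) (t * x) = t * (\<delta> ^^ k) x" if "\<delta> t = 0"
  by (induction k) (simp_all add: derivation_mult that)

lemmas derivation_simps =
  derivation_add derivation_mult derivation_0 derivation_1 derivation_minus derivation_diff
  derivation_of_nat derivation_numeral

end


section \<open>Differential polynomial functions\<close>

text \<open>Homogenisations are much easier to handle as functions than as formal polynomials. The aim of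
  this section is therefore that the functions induced by differential polynomials over \<open>F\<close> form a
  ring that is closed under \<open>\<delta>\<close>.\<close>

definition mono_val :: "('u::field_char_0 \<Rightarrow> 'u) \<Rightarrow> ('v \<Rightarrow> 'u) \<Rightarrow> ('v \<times> nat \<Rightarrow>\<^sub>0 nat) \<Rightarrow> 'u" where
  "mono_val \<delta> x m =
     (\<Prod>(v, k)\<in>Poly_Mapping.keys m. (\<delta> ^^ k) (x v) ^ Poly_Mapping.lookup m (v, k))"

lemma deval_mono_val:
  "deval \<delta> g x = (\<Sum>m\<in>Poly_Mapping.keys g. Poly_Mapping.lookup g m * mono_val \<delta> x m)"
  by (simp add: deval_def mono_val_def)

lemma mono_val_superset:
  assumes "finite K" "Poly_Mapping.keys m \<subseteq> K"
  shows "mono_val \<delta> x m = (\<Prod>(v, k)\<in>K. (\<delta> ^^ k) (x v) ^ Poly_Mapping.lookup m (v, k))"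
  unfolding mono_val_def using assms
  by (intro prod.mono_neutral_left) (auto simp: in_keys_iff)

lemma mono_val_add: "mono_val \<delta> x (m + m') = mono_val \<delta> x m * mono_val \<delta> x m'"
proof -
  let ?K = "Poly_Mapping.keys m \<union> Poly_Mapping.keys m'"
  have "mono_val \<delta> x (m + m') =
      (\<Prod>(v, k)\<in>?K. (\<delta> ^^ k) (x v) ^ Poly_Mapping.lookup (m + m') (v, k))"
    by (intro mono_val_superset Poly_Mapping.keys_add) simp
  also have "\<dots> = (\<Prod>(v, k)\<in>?K. (\<delta> ^^ k) (x v) ^ Poly_Mapping.lookup m (v, k)) *
      (\<Prod>(v, k)\<in>?K. (\<delta> ^^ k) (x v) ^ Poly_Mapping.lookup m' (v, k))"
    by (simp add: prod.distrib[symmetric] lookup_add power_add case_prod_unfold)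
  also have "\<dots> = mono_val \<delta> x m * mono_val \<delta> x m'"
    by (simp add: mono_val_superset[symmetric])
  finally show ?thesis .
qed

lemma mono_val_0: "mono_val \<delta> x 0 = 1"
  by (simp add: mono_val_def)

lemma mono_val_single: "mono_val \<delta> x (Poly_Mapping.single (v, k) e) = (\<delta> ^^ k) (x v) ^ e"
  by (cases "e = 0") (simp_all add: mono_val_def)

lemma deval_zero: "deval \<delta> 0 x = 0"
  by (simp add: deval_def)

lemma deval_single: "deval \<delta> (Poly_Mapping.single m c) x = c * mono_val \<delta> x m"
  by (cases "c = 0") (simp_all add: deval_mono_val)

lemma deval_add: "deval \<delta> (f + g) x = deval \<delta> f x + deval \<delta> g x"
  unfolding deval_mono_val
  by (rule setsum_keys_plus_distrib) (simp_all add: distrib_right)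

lemma dpoly_over_single:
  assumes "0 \<in> F" "c \<in> F" "fst ` Poly_Mapping.keys m \<subseteq> I"
  shows "dpoly_over F I (Poly_Mapping.single m c)"
  using assms by (cases "c = 0") (auto simp: dpoly_over_def dvars_def lookup_single when_def)

lemma dpoly_over_add:
  assumes "delta_subfield \<delta> F" "dpoly_over F I f" "dpoly_over F I g"
  shows "dpoly_over F I (f + g)"
proof -
  have "dvars (f + g) \<subseteq> dvars f \<union> dvars g"
    using Poly_Mapping.keys_add[of f g] by (auto simp: dvars_def)
  then have "fst ` dvars (f + g) \<subseteq> I"
    using assms(2,3) unfolding dpoly_over_def by blast
  then show ?thesis
    using assms by (auto simp: dpoly_over_def lookup_add delta_subfield_def)
qed

text \<open>The induction adds one term at a time and stays within the polynomials over \<open>F\<close>, so that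
  closure of the coefficients under multiplication and the value of a product follow together.\<close>
lemma dpoly_over_induct [consumes 2, case_names zero add]:
  assumes "0 \<in> F" "dpoly_over F I f"
    and zero: "P 0"
    and add: "\<And>f m c. dpoly_over F I f \<Longrightarrow> P f \<Longrightarrow> c \<in> F \<Longrightarrow>
      fst ` Poly_Mapping.keys m \<subseteq> I \<Longrightarrow> P (f + Poly_Mapping.single m c)"
  shows "P f"
  using \<open>dpoly_over F I f\<close>
proof (induction f rule: update_induct)
  case const
  show ?case by (fact zero)
next
  case (update f m c)
  have lookup: "Poly_Mapping.lookup (Poly_Mapping.update m c f) =
      (Poly_Mapping.lookup f)(m := c)"
    by (simp add: update.rep_eq)
  have eq: "Poly_Mapping.update m c f = f + Poly_Mapping.single m c"
    using update(1)
    by (intro poly_mapping_eqI) (auto simp: lookup lookup_add lookup_single in_keys_iff when_def)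
  have keys: "Poly_Mapping.keys (Poly_Mapping.update m c f) = insert m (Poly_Mapping.keys f)"
    using update(1,2) by (auto simp: in_keys_iff lookup split: if_splits)
  have coeffs: "Poly_Mapping.lookup f m' \<in> F" for m'
  proof (cases "m' = m")
    case True
    then show ?thesis using update(1) \<open>0 \<in> F\<close> by (simp add: in_keys_iff)
  next
    case False
    then show ?thesis
      using update.prems by (auto simp: dpoly_over_def lookup dest: spec[of _ m'])
  qed
  have "c \<in> F"
    using update.prems by (auto simp: dpoly_over_def lookup dest: spec[of _ m])
  moreover have "fst ` Poly_Mapping.keys m \<subseteq> I" "fst ` dvars f \<subseteq> I"
    using update.prems unfolding dpoly_over_def dvars_def keys by auto
  ultimately show ?case
    unfolding eq using coeffs update.IH by (intro add) (auto simp: dpoly_over_def)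
qed

lemma dpoly_over_mult_single:
  assumes F: "delta_subfield \<delta> F" and g: "dpoly_over F I g"
    and "c \<in> F" "fst ` Poly_Mapping.keys m \<subseteq> I"
  shows "dpoly_over F I (Poly_Mapping.single m c * g) \<and>
    deval \<delta> (Poly_Mapping.single m c * g) x = c * mono_val \<delta> x m * deval \<delta> g x"
proof -
  have "0 \<in> F" using F by (simp add: delta_subfield_def)
  from this g show ?thesis
  proof (induction rule: dpoly_over_induct)
    case zero
    show ?case using \<open>0 \<in> F\<close> by (simp add: deval_zero dpoly_over_def dvars_def)
  next
    case (add f m' c')
    have "fst ` Poly_Mapping.keys (m + m') \<subseteq> I"
      using Poly_Mapping.keys_add[of m m'] assms(4) add by blast
    moreover have "c * c' \<in> F"
      using F \<open>c \<in> F\<close> add by (simp add: delta_subfield_def)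
    ultimately have "dpoly_over F I (Poly_Mapping.single (m + m') (c * c'))"
      using \<open>0 \<in> F\<close> by (intro dpoly_over_single)
    then show ?case
      using add by (simp add: distrib_left mult_single deval_add deval_single mono_val_add
          dpoly_over_add[OF F])
  qed
qed

lemma dpoly_over_mult:
  assumes F: "delta_subfield \<delta> F" and f: "dpoly_over F I f" and g: "dpoly_over F I g"
  shows "dpoly_over F I (f * g) \<and> (\<forall>x. deval \<delta> (f * g) x = deval \<delta> f x * deval \<delta> g x)"
proof -
  have "0 \<in> F" using F by (simp add: delta_subfield_def)
  from this f show ?thesis
  proof (induction rule: dpoly_over_induct)
    case zero
    show ?case using \<open>0 \<in> F\<close> by (simp add: deval_zero dpoly_over_def dvars_def)
  next
    case (add f m c)
    then show ?case
      using dpoly_over_mult_single[OF F g, of c m]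
      by (simp add: distrib_right deval_add deval_single dpoly_over_add[OF F])
  qed
qed

definition dpoly_fun ::
  "('u::field_char_0 \<Rightarrow> 'u) \<Rightarrow> 'u set \<Rightarrow> 'v set \<Rightarrow> (('v \<Rightarrow> 'u) \<Rightarrow> 'u) \<Rightarrow> bool" where
  "dpoly_fun \<delta> F I \<phi> \<longleftrightarrow> (\<exists>g. dpoly_over F I g \<and> (\<forall>x. deval \<delta> g x = \<phi> x))"

context
  fixes \<delta> :: "'u::field_char_0 \<Rightarrow> 'u" and F :: "'u set" and I :: "'v set"
  assumes F: "delta_subfield \<delta> F"
begin

lemma dpoly_fun_const: "c \<in> F \<Longrightarrow> dpoly_fun \<delta> F I (\<lambda>_. c)"
  unfolding dpoly_fun_def using F
  by (intro exI[of _ "Poly_Mapping.single 0 c"])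
    (auto simp: deval_single mono_val_0 delta_subfield_def intro!: dpoly_over_single)

lemma dpoly_fun_iterate: "v \<in> I \<Longrightarrow> dpoly_fun \<delta> F I (\<lambda>x. (\<delta> ^^ k) (x v))"
  unfolding dpoly_fun_def using F
  by (intro exI[of _ "Poly_Mapping.single (Poly_Mapping.single (v, k) 1) 1"])
    (auto simp: deval_single mono_val_single delta_subfield_def intro!: dpoly_over_single)

lemma dpoly_fun_var: "v \<in> I \<Longrightarrow> dpoly_fun \<delta> F I (\<lambda>x. x v)"
  using dpoly_fun_iterate[of v 0] by simp

lemma dpoly_fun_add:
  assumes "dpoly_fun \<delta> F I \<phi>" "dpoly_fun \<delta> F I \<psi>"
  shows "dpoly_fun \<delta> F I (\<lambda>x. \<phi> x + \<psi> x)"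
  using assms unfolding dpoly_fun_def
  by (metis deval_add dpoly_over_add[OF F])

lemma dpoly_fun_mult:
  assumes "dpoly_fun \<delta> F I \<phi>" "dpoly_fun \<delta> F I \<psi>"
  shows "dpoly_fun \<delta> F I (\<lambda>x. \<phi> x * \<psi> x)"
  using assms unfolding dpoly_fun_def
  by (metis dpoly_over_mult[OF F])

lemma delta_subfield_of_nat: "of_nat m \<in> F"
  using F by (induction m) (auto simp: delta_subfield_def)

lemma dpoly_fun_of_nat: "dpoly_fun \<delta> F I (\<lambda>_. of_nat m)"
  by (rule dpoly_fun_const[OF delta_subfield_of_nat])

lemma dpoly_fun_numeral: "dpoly_fun \<delta> F I (\<lambda>_. numeral m)"
  using dpoly_fun_of_nat[of "numeral m"] by simp

lemma dpoly_fun_minus: "dpoly_fun \<delta> F I \<phi> \<Longrightarrow> dpoly_fun \<delta> F I (\<lambda>x. - \<phi> x)"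
  using dpoly_fun_mult[OF dpoly_fun_const[of "- 1"]] F by (simp add: delta_subfield_def)

lemma dpoly_fun_diff:
  "dpoly_fun \<delta> F I \<phi> \<Longrightarrow> dpoly_fun \<delta> F I \<psi> \<Longrightarrow> dpoly_fun \<delta> F I (\<lambda>x. \<phi> x - \<psi> x)"
  using dpoly_fun_add[OF _ dpoly_fun_minus] by simp

lemma dpoly_fun_power: "dpoly_fun \<delta> F I \<phi> \<Longrightarrow> dpoly_fun \<delta> F I (\<lambda>x. \<phi> x ^ m)"
proof (induction m)
  case 0
  then show ?case using dpoly_fun_of_nat[of 1] by simp
qed (simp add: dpoly_fun_mult)

lemma dpoly_fun_sum:
  "(\<And>a. a \<in> A \<Longrightarrow> dpoly_fun \<delta> F I (\<phi> a)) \<Longrightarrow> dpoly_fun \<delta> F I (\<lambda>x. \<Sum>a\<in>A. \<phi> a x)"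
proof (induction A rule: infinite_finite_induct)
  case (insert a A)
  then show ?case by (simp add: dpoly_fun_add)
qed (use dpoly_fun_of_nat[of 0] in simp_all)

text \<open>By the product rule, the functions that are induced by differential polynomials together with
  their derivatives are closed under products and powers. They contain the variables and all their
  derivatives, hence every monomial.\<close>
lemma dpoly_fun_derivation:
  assumes der: "derivation \<delta>" and "dpoly_fun \<delta> F I \<phi>"
  shows "dpoly_fun \<delta> F I (\<lambda>x. \<delta> (\<phi> x))"
proof -
  define C where "C \<psi> \<longleftrightarrow> dpoly_fun \<delta> F I \<psi> \<and> dpoly_fun \<delta> F I (\<lambda>x. \<delta> (\<psi> x))" for \<psi>
  have const: "C (\<lambda>_. c)" if "c \<in> F" for c
    using that F by (auto simp: C_def delta_subfield_def intro!: dpoly_fun_const)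
  have mult: "C (\<lambda>x. \<psi> x * \<chi> x)" if "C \<psi>" "C \<chi>" for \<psi> \<chi>
    using that by (auto simp: C_def derivation_mult[OF der] intro!: dpoly_fun_mult dpoly_fun_add)
  have one: "C (\<lambda>_. 1)"
    using const[of 1] F by (simp add: delta_subfield_def)
  have power: "C (\<lambda>x. \<psi> x ^ m)" if "C \<psi>" for \<psi> m
    by (induction m) (simp_all add: one mult that)
  have prod: "C (\<lambda>x. \<Prod>a\<in>A. \<psi> a x)" if "\<And>a. a \<in> A \<Longrightarrow> C (\<psi> a)"
    for A :: "('v \<times> nat) set" and \<psi>
    using that by (induction A rule: infinite_finite_induct) (simp_all add: one mult)
  have iterate: "C (\<lambda>x. (\<delta> ^^ k) (x v))" if "v \<in> I" for v k
    using dpoly_fun_iterate[OF that, of k] dpoly_fun_iterate[OF that, of "Suc k"]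
    by (simp add: C_def)
  from assms(2) obtain g where g: "dpoly_over F I g" "\<And>x. deval \<delta> g x = \<phi> x"
    by (auto simp: dpoly_fun_def)
  have "C (\<lambda>x. Poly_Mapping.lookup g m * mono_val \<delta> x m)" if "m \<in> Poly_Mapping.keys g" for m
    unfolding mono_val_def case_prod_unfold
    using that g(1)
    by (intro mult const prod power iterate) (auto simp: dpoly_over_def dvars_def)
  then have "dpoly_fun \<delta> F I (\<lambda>x. \<delta> (deval \<delta> g x))"
    unfolding deval_mono_val derivation_sum[OF der] by (intro dpoly_fun_sum) (simp add: C_def)
  then show ?thesis by (simp add: g(2))
qed

lemmas dpoly_fun_intros =
  dpoly_fun_var dpoly_fun_of_nat dpoly_fun_numeral dpoly_fun_add dpoly_fun_diff dpoly_fun_mult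
  dpoly_fun_power

end


section \<open>Closed subsets of a product of projective spaces\<close>

text \<open>The identities are required for all scalars of the universe, not just for those of \<open>F\<close>. This is
  what makes vanishing independent of the chosen homogeneous coordinates.\<close>
definition bihomogeneous_dfun ::
  "('u::field_char_0 \<Rightarrow> 'u) \<Rightarrow> 'u set \<Rightarrow> nat \<Rightarrow> nat \<Rightarrow> ((nat + nat \<Rightarrow> 'u) \<Rightarrow> 'u) \<Rightarrow> bool" where
  "bihomogeneous_dfun \<delta> F n m \<psi> \<longleftrightarrow>
     dpoly_fun \<delta> F (Inl ` {..n} \<union> Inr ` {..m}) \<psi> \<and>
     (\<exists>d. \<forall>c x. \<psi> (\<lambda>v. if v \<in> Inl ` {..n} then c * x v else x v) = c ^ d * \<psi> x) \<and>
     (\<exists>d. \<forall>c x. \<psi> (\<lambda>v. if v \<in> Inr ` {..m} then c * x v else x v) = c ^ d * \<psi> x)"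

lemma bihomogeneous_dfunI:
  assumes "dpoly_fun \<delta> F (Inl ` {..n} \<union> Inr ` {..m}) \<psi>"
    and "\<And>c x. \<psi> (\<lambda>v. if v \<in> Inl ` {..n} then c * x v else x v) = c ^ d * \<psi> x"
    and "\<And>c x. \<psi> (\<lambda>v. if v \<in> Inr ` {..m} then c * x v else x v) = c ^ e * \<psi> x"
  shows "bihomogeneous_dfun \<delta> F n m \<psi>"
  using assms unfolding bihomogeneous_dfun_def by blast

lemma closed_in_product_zero_locus:
  assumes "\<And>\<psi>. \<psi> \<in> \<Psi> \<Longrightarrow> bihomogeneous_dfun \<delta> F n m \<psi>"
  shows "closed_in_product \<delta> F n m
    {(p, q) \<in> proj_space n \<times> proj_space m. \<forall>x\<in>p. \<forall>y\<in>q. \<forall>\<psi>\<in>\<Psi>. \<psi> (case_sum x y) = 0}"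
proof -
  have "\<exists>g. dpoly_over F (Inl ` {..n} \<union> Inr ` {..m}) g \<and> (\<forall>x. deval \<delta> g x = \<psi> x)"
    if "\<psi> \<in> \<Psi>" for \<psi>
    using assms[OF that] by (simp add: bihomogeneous_dfun_def dpoly_fun_def)
  then obtain G where G: "dpoly_over F (Inl ` {..n} \<union> Inr ` {..m}) (G \<psi>)"
      "deval \<delta> (G \<psi>) x = \<psi> x" if "\<psi> \<in> \<Psi>" for \<psi> x
    by metis
  have "dhomogeneous \<delta> F (Inl ` {..n}) (G \<psi>)" "dhomogeneous \<delta> F (Inr ` {..m}) (G \<psi>)"
    if "\<psi> \<in> \<Psi>" for \<psi>
    using assms[OF that] unfolding dhomogeneous_def bihomogeneous_dfun_def G(2)[OF that] by blast+
  then show ?thesis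
    unfolding closed_in_product_def using G by (intro exI[of _ "G ` \<Psi>"]) auto
qed

lemma affine_point_in_proj_space: "affine_point a \<in> proj_space 1"
  unfolding affine_point_def proj_space_def mem_Collect_eq
  by (rule exI, rule conjI, rule refl) (auto intro: exI[of _ 1])

lemma mem_affine_point_iff:
  "x \<in> affine_point a \<longleftrightarrow>
     (\<exists>c. c \<noteq> 0 \<and> x = (\<lambda>i. if i = 0 then c * a else if i = 1 then c else 0))"
proof -
  have "(\<lambda>i. c * (if i = 0 then a else if i = 1 then 1 else 0)) =
      (\<lambda>i::nat. if i = 0 then c * a else if i = 1 then c else 0)" for c
    by auto
  then show ?thesis
    by (simp add: affine_point_def proj_point_def) metis
qed

lemma ball_affine_point_iff:
  "(\<forall>x\<in>affine_point a. P x) \<longleftrightarrow>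
     (\<forall>c. c \<noteq> 0 \<longrightarrow> P (\<lambda>i. if i = 0 then c * a else if i = 1 then c else 0))"
  unfolding Ball_def mem_affine_point_iff by blast

lemma proj_space_1_cases:
  assumes "p \<in> proj_space 1"
  obtains (affine) a where "p = affine_point a"
    | (infinity) x where "x \<in> p" "x 0 \<noteq> 0" "x 1 = 0"
proof -
  obtain x where p: "p = proj_point x" and x: "\<exists>i\<le>1. x i \<noteq> 0" "\<forall>i>1. x i = 0"
    using assms by (auto simp: proj_space_def)
  have "x \<in> p"
    unfolding p proj_point_def by (intro CollectI exI[of _ 1]) simp
  show thesis
  proof (cases "x 1 = 0")
    case True
    moreover have "x 0 \<noteq> 0"
      using x(1) True by (metis le_Suc_eq One_nat_def le_zero_eq)
    ultimately show thesis using \<open>x \<in> p\<close> infinity by blast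
  next
    case False
    have x_eq: "x = (\<lambda>i. if i = 0 then x 0 else if i = 1 then x 1 else 0)"
      using x(2) by (auto simp: fun_eq_iff)
    have "p = affine_point (x 0 / x 1)"
    proof (intro set_eqI iffI)
      fix y assume "y \<in> p"
      then obtain c where "c \<noteq> 0" "y = (\<lambda>i. c * x i)"
        by (auto simp: p proj_point_def)
      then show "y \<in> affine_point (x 0 / x 1)"
        unfolding mem_affine_point_iff using False x(2)
        by (intro exI[of _ "c * x 1"]) (auto simp: fun_eq_iff)
    next
      fix y assume "y \<in> affine_point (x 0 / x 1)"
      then obtain c where "c \<noteq> 0"
        "y = (\<lambda>i. if i = 0 then c * (x 0 / x 1) else if i = 1 then c else 0)"
        unfolding mem_affine_point_iff by blast
      then show "y \<in> p"
        unfolding p proj_point_def using False x(2)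
        by (intro CollectI exI[of _ "c / x 1"]) (auto simp: fun_eq_iff)
    qed
    then show thesis by (rule affine)
  qed
qed

lemma proj_variety_proj_space: "proj_variety \<delta> F n (proj_space n)"
  unfolding proj_variety_def by (intro exI[of _ "{}"]) auto

lemma affine_point_subset_closure: "affine_point ` X \<subseteq> projective_closure \<delta> F X"
  by (auto simp: projective_closure_def)


section \<open>Specialising a constant\<close>

text \<open>For a constant \<open>t\<close> the \<open>k\<close>-th derivative of \<open>c t\<close> is \<open>t\<close> times that of \<open>c\<close>, so the value at the
  coordinates \<open>(c t, c)\<close> is an ordinary polynomial in \<open>t\<close>, and one that has infinitely many zeros is
  zero. The factor \<open>c\<close> reaches every coordinate vector of a point, not only the normalised one.\<close>
lemma deval_vanishes_at_limit_of_constants: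
  assumes der: "derivation \<delta>"
    and zero: "\<And>j. deval \<delta> g
      (\<lambda>i::nat. if i = 0 then c * of_nat (Suc j) else if i = 1 then c else 0) = 0"
  shows "deval \<delta> g (\<lambda>i. if i = 0 then 0 else if i = 1 then c else 0) = 0"
proof -
  define pt where "pt t = (\<lambda>i::nat. if i = 0 then c * t else if i = 1 then c else 0)" for t
  \<comment> \<open>the \<open>k\<close>-th derivative of coordinate \<open>v\<close> of \<open>pt t\<close>, as a polynomial in the constant \<open>t\<close>\<close>
  define coord where "coord v k =
      (if v = 0 then [:0, (\<delta> ^^ k) c:] else if v = 1 then [:(\<delta> ^^ k) c:] else 0)"
    for v k :: nat
  define P where "P = (\<Sum>m\<in>Poly_Mapping.keys g. smult (Poly_Mapping.lookup g m)
      (\<Prod>(v, k)\<in>Poly_Mapping.keys m. coord v k ^ Poly_Mapping.lookup m (v, k)))"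
  have coord: "poly (coord v k) t = (\<delta> ^^ k) (pt t v)" if "\<delta> t = 0" for v k t
    using derivation_iterate_constant_mult[OF der that, of k c]
    by (simp add: coord_def pt_def derivation_iterate_0[OF der] mult.commute)
  have P: "poly P t = deval \<delta> g (pt t)" if "\<delta> t = 0" for t
    by (simp add: P_def deval_def poly_sum poly_prod case_prod_unfold coord[OF that])
  have "poly P (of_nat (Suc j)) = 0" for j
    using zero[of j] P[OF derivation_of_nat[OF der, of "Suc j"]] by (simp add: pt_def del: of_nat_Suc)
  then have "range (\<lambda>j. of_nat (Suc j)) \<subseteq> {t. poly P t = 0}"
    by blast
  moreover have "infinite (range (\<lambda>j. of_nat (Suc j) :: 'a))"
    by (intro range_inj_infinite injI) (simp only: of_nat_eq_iff nat.inject)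
  ultimately have "P = 0"
    using poly_roots_finite finite_subset by blast
  then have "deval \<delta> g (pt 0) = 0"
    using P[of 0] by (simp add: derivation_0[OF der])
  moreover have "pt 0 = (\<lambda>i. if i = 0 then 0 else if i = 1 then c else 0)"
    by (auto simp: pt_def)
  ultimately show ?thesis by simp
qed


section \<open>Solutions of prescribed energy\<close>

text \<open>Blum's axiom is applied to the energy equation, of order one, with the side condition that
  \<open>x'\<close> does not vanish. Modulo the energy equation this condition has order zero, as the axiom
  demands.\<close>
lemma ex_solution_with_energy:
  fixes \<delta> :: "'u::field_char_0 \<Rightarrow> 'u"
  assumes der: "derivation \<delta>" and closed: "differentially_closed \<delta> UNIV"
    and t: "t \<noteq> 0" "\<delta> t = 0"
  shows "\<exists>x. \<delta> (\<delta> x) = x ^ n \<and> t * (of_nat (n + 1) * (\<delta> x)\<^sup>2 - 2 * x ^ (n + 1)) = 1"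
proof -
  let ?k = "of_nat (n + 1) :: 'u"
  let ?x = "\<lambda>e. Poly_Mapping.single ((), 0::nat) (e::nat)"
  let ?x' = "\<lambda>e. Poly_Mapping.single ((), 1::nat) (e::nat)"
  \<comment> \<open>\<open>f\<close> is the energy equation, and where \<open>f\<close> vanishes \<open>g\<close> equals \<open>t (n + 1) x'\<^sup>2\<close>\<close>
  define f where "f = Poly_Mapping.single (?x' 2) (t * ?k)
      + Poly_Mapping.single (?x (n + 1)) (- 2 * t) + Poly_Mapping.single 0 (- 1)"
  define g where "g = Poly_Mapping.single (?x (n + 1)) (2 * t) + Poly_Mapping.single 0 1"
  have k: "?k \<noteq> 0"
    by (simp only: of_nat_eq_0_iff)
  have ne: "?x (n + 1) \<noteq> ?x' 2" "?x' 2 \<noteq> 0" "?x (n + 1) \<noteq> 0"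
    by (auto dest!: arg_cong[where f = Poly_Mapping.keys])
  have "Poly_Mapping.lookup f (?x' 2) = t * ?k"
    by (simp only: f_def lookup_add lookup_single_eq lookup_single_not_eq[OF ne(1)]
        lookup_single_not_eq[OF ne(2)[symmetric]] add_0_right)
  then have "Poly_Mapping.lookup f (?x' 2) \<noteq> 0"
    using t(1) k by (simp only: mult_eq_0_iff simp_thms)
  then have "((), 1) \<in> dvars f"
    unfolding dvars_def by (intro UN_I[of "?x' 2"]) (auto simp: in_keys_iff)
  then have "1 \<in> snd ` dvars f" and "dvars f \<noteq> {}"
    by force+
  moreover have "finite (snd ` dvars f)"
    by (simp add: dvars_def)
  ultimately have "dorder f \<ge> 1"
    using Max_ge[of "snd ` dvars f" 1] by (simp add: dorder_def)
  have "Poly_Mapping.keys g \<subseteq> {?x (n + 1), 0}"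
    unfolding g_def by (rule order_trans[OF Poly_Mapping.keys_add]) auto
  moreover have "Poly_Mapping.keys m \<subseteq> {((), 0)}" if "m \<in> {?x (n + 1), 0}" for m
    using that by auto
  ultimately have "dvars g \<subseteq> {((), 0)}"
    unfolding dvars_def by blast
  then have "dvars g = {} \<or> dvars g = {((), 0)}"
    by (simp only: subset_singleton_iff)
  then have "dorder g \<le> 0"
    unfolding dorder_def by (elim disjE) simp_all
  have "Poly_Mapping.lookup g 0 = 1"
    by (simp only: g_def lookup_add lookup_single_eq lookup_single_not_eq[OF ne(3)] add_0_left)
  then have "g \<noteq> 0"
    by (metis lookup_zero zero_neq_one)
  moreover have "dorder g < dorder f"
    using \<open>dorder f \<ge> 1\<close> \<open>dorder g \<le> 0\<close> by simp
  moreover have "dpoly_over UNIV UNIV h" for h :: "(unit, 'u) dpoly"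
    by (simp add: dpoly_over_def)
  ultimately have "\<exists>x\<in>UNIV. deval \<delta> f (\<lambda>_. x) = 0 \<and> deval \<delta> g (\<lambda>_. x) \<noteq> 0"
    by (intro closed[unfolded differentially_closed_def, rule_format] conjI)
  then obtain x where x: "deval \<delta> f (\<lambda>_. x) = 0" "deval \<delta> g (\<lambda>_. x) \<noteq> 0"
    by blast
  have iterates: "(\<delta> ^^ 0) x = x" "(\<delta> ^^ 1) x = \<delta> x"
    by simp_all
  have "deval \<delta> f (\<lambda>_. x) = t * ?k * (\<delta> x)\<^sup>2 + - 2 * t * x ^ (n + 1) + - 1"
    and g_val: "deval \<delta> g (\<lambda>_. x) = 2 * t * x ^ (n + 1) + 1"
    by (simp_all only: f_def g_def deval_add deval_single mono_val_single mono_val_0 iterates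
        mult_1_right)
  with x(1) have "t * ?k * (\<delta> x)\<^sup>2 + - 2 * t * x ^ (n + 1) + - 1 = 0"
    by (simp only:)
  then have energy: "t * ?k * (\<delta> x)\<^sup>2 = 2 * t * x ^ (n + 1) + 1"
    by (simp add: algebra_simps)
  have "\<delta> x \<noteq> 0"
    using energy x(2) unfolding g_val by force
  have "\<delta> (t * ?k * (\<delta> x)\<^sup>2) = 2 * t * ?k * \<delta> x * \<delta> (\<delta> x)"
    using t(2) unfolding derivation_mult[OF der] derivation_of_nat[OF der] power2_eq_square
    by (simp add: algebra_simps)
  note lhs = this[unfolded energy]
  have "\<delta> (2 * t * x ^ (n + 1) + 1) = 2 * t * ?k * \<delta> x * x ^ n"
    using t(2)
    unfolding derivation_add[OF der] derivation_mult[OF der] derivation_numeral[OF der]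
      derivation_1[OF der] derivation_power[OF der]
    by (simp add: algebra_simps)
  from trans[OF lhs[symmetric] this]
  have "2 * t * ?k * \<delta> x * \<delta> (\<delta> x) = 2 * t * ?k * \<delta> x * x ^ n" .
  moreover have "2 * t * ?k * \<delta> x \<noteq> 0"
    using t(1) k \<open>\<delta> x \<noteq> 0\<close> by (simp del: of_nat_add of_nat_Suc)
  ultimately have "\<delta> (\<delta> x) = x ^ n"
    using mult_left_cancel by blast
  moreover have "t * (?k * (\<delta> x)\<^sup>2 - 2 * x ^ (n + 1)) = 1"
    using energy by (simp add: algebra_simps)
  ultimately show ?thesis by blast
qed


section \<open>Homogenisation\<close>

context
  fixes \<delta> :: "'u::field_char_0 \<Rightarrow> 'u"
  assumes der: "derivation \<delta>"
begin

text \<open>For \<open>b \<noteq> 0\<close> this is \<open>b\<^sup>2 (a / b)'\<close>, the derivative of the affine coordinate cleared of its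
  denominator.\<close>
definition wronskian :: "'u \<Rightarrow> 'u \<Rightarrow> 'u" where
  "wronskian a b = \<delta> a * b - a * \<delta> b"

text \<open>For \<open>b \<noteq> 0\<close> this is \<open>b\<^sup>3 (a / b)''\<close>.\<close>
definition hom_second :: "'u \<Rightarrow> 'u \<Rightarrow> 'u" where
  "hom_second a b = \<delta> (wronskian a b) * b - 2 * wronskian a b * \<delta> b"

lemma wronskian_scale: "wronskian (c * a) (c * b) = c ^ 2 * wronskian a b"
  by (simp add: wronskian_def derivation_simps[OF der] power2_eq_square algebra_simps)

lemma hom_second_scale: "hom_second (c * a) (c * b) = c ^ 3 * hom_second a b"
  unfolding hom_second_def wronskian_scale
  by (simp add: derivation_simps[OF der] power2_eq_square power3_eq_cube algebra_simps)

lemma dpoly_fun_wronskian: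
  assumes F: "delta_subfield \<delta> F" and "dpoly_fun \<delta> F I \<phi>" "dpoly_fun \<delta> F I \<psi>"
  shows "dpoly_fun \<delta> F I (\<lambda>x. wronskian (\<phi> x) (\<psi> x))"
  unfolding wronskian_def
  by (intro dpoly_fun_intros[OF F] dpoly_fun_derivation[OF F der] assms)

lemma dpoly_fun_hom_second:
  assumes F: "delta_subfield \<delta> F" and "dpoly_fun \<delta> F I \<phi>" "dpoly_fun \<delta> F I \<psi>"
  shows "dpoly_fun \<delta> F I (\<lambda>x. hom_second (\<phi> x) (\<psi> x))"
  unfolding hom_second_def
  by (intro dpoly_fun_intros[OF F] dpoly_fun_derivation[OF F der] dpoly_fun_wronskian assms)

text \<open>For \<open>n \<ge> 3\<close> the factor \<open>b\<^sup>n\<close> that clears the denominator of \<open>x\<^sup>n\<close> also clears that of \<open>x''\<close>,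
  and only the term \<open>- a\<^sup>n\<close> survives at infinity.

  For \<open>n = 2\<close> the denominator of \<open>x''\<close> is the larger one, and the homogenised equation vanishes at
  infinity. In terms of \<open>u = 1 / x\<close> the equation reads \<open>u (1 + u'') = 2 u'\<^sup>2\<close>. Differentiation gives
  \<open>u' (1 - 3 u'') = - u u'''\<close>. Multiplying by \<open>1 + u''\<close>, inserting the first equation and cancelling
  \<open>u'\<close> yields \<open>(1 - 3 u'') (1 + u'') + 2 u' u''' = 0\<close>, whose left-hand side is \<open>1\<close> at \<open>u = 0\<close>. The
  cancellation is harmless, since a solution with \<open>x' = 0\<close> is \<open>x = 0\<close>, where \<open>u\<close> is not
  defined.\<close>
lemma ex_hom_dpoly_separating_infinity:
  assumes F: "delta_subfield \<delta> F" and "n \<ge> 2" and vw: "v \<in> I" "w \<in> I"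
  obtains Q d where
    "\<forall>c a b. Q (c * a) (c * b) = c ^ d * Q a b"
    "dpoly_fun \<delta> F I (\<lambda>x. Q (x v) (x w))"
    "\<forall>a. \<delta> (\<delta> a) = a ^ n \<longrightarrow> Q a 1 = 0"
    "\<forall>a. a \<noteq> 0 \<longrightarrow> Q a 0 \<noteq> 0"
proof (cases "n = 2")
  case False
  define k where "k = n - 3"
  with False \<open>n \<ge> 2\<close> have n: "n = k + 3" by simp
  define Q where "Q a b = b ^ k * hom_second a b - a ^ n" for a b
  show thesis
  proof (rule that[of Q n]; (intro allI impI)?)
    show "Q (c * a) (c * b) = c ^ n * Q a b" for c a b
      unfolding Q_def hom_second_scale n by (simp add: power_add power_mult_distrib algebra_simps)
    show "dpoly_fun \<delta> F I (\<lambda>x. Q (x v) (x w))"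
      unfolding Q_def by (intro dpoly_fun_intros[OF F] dpoly_fun_hom_second[OF F] vw)
    show "Q a 1 = 0" if "\<delta> (\<delta> a) = a ^ n" for a
      using that by (simp add: Q_def hom_second_def wronskian_def derivation_simps[OF der])
    show "Q a 0 \<noteq> 0" if "a \<noteq> 0" for a
      using that by (simp add: Q_def hom_second_def wronskian_def derivation_simps[OF der])
  qed
next
  case True
  \<comment> \<open>for \<open>b \<noteq> 0\<close> this is \<open>b\<^sup>4 (a / b)'''\<close>\<close>
  define hom_third where
    "hom_third a b = \<delta> (hom_second a b) * b - 3 * hom_second a b * \<delta> b" for a b
  \<comment> \<open>\<open>a\<^sup>6\<close> times the relation for \<open>u = b / a\<close>; hence the exchanged arguments\<close>
  define Q where
    "Q a b = (a ^ 3 - 3 * hom_second b a) * (a ^ 3 + hom_second b a)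
        + 2 * wronskian b a * hom_third b a" for a b
  have hom_third_scale: "hom_third (c * a) (c * b) = c ^ 4 * hom_third a b" for a b c
    unfolding hom_third_def hom_second_scale
    by (simp add: derivation_simps[OF der] eval_nat_numeral algebra_simps)
  show thesis
  proof (rule that[of Q 6]; (intro allI impI)?)
    show "Q (c * a) (c * b) = c ^ 6 * Q a b" for c a b
      unfolding Q_def hom_third_scale hom_second_scale wronskian_scale
      by (simp add: eval_nat_numeral algebra_simps)
    show "dpoly_fun \<delta> F I (\<lambda>x. Q (x v) (x w))"
      unfolding Q_def hom_third_def
      by (intro dpoly_fun_intros[OF F] dpoly_fun_hom_second[OF F] dpoly_fun_wronskian[OF F]
          dpoly_fun_derivation[OF F der] vw)
    show "Q a 1 = 0" if a: "\<delta> (\<delta> a) = a ^ n" for a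
    proof -
      have a2: "\<delta> (\<delta> a) = a * a"
        using a True by (simp add: power2_eq_square)
      have W: "wronskian 1 a = - \<delta> a"
        by (simp add: wronskian_def derivation_simps[OF der])
      have S: "hom_second 1 a = 2 * \<delta> a * \<delta> a - a * a * a"
        unfolding hom_second_def W by (simp add: derivation_simps[OF der] a2 algebra_simps)
      have T: "hom_third 1 a = 4 * a * a * a * \<delta> a - 6 * \<delta> a * \<delta> a * \<delta> a"
        unfolding hom_third_def S by (simp add: derivation_simps[OF der] a2 algebra_simps)
      show ?thesis
        unfolding Q_def W S T by (simp add: power3_eq_cube algebra_simps)
    qed
    show "Q a 0 \<noteq> 0" if "a \<noteq> 0" for a
      using that
      by (simp add: Q_def hom_third_def hom_second_def wronskian_def derivation_simps[OF der])
  qed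
qed

text \<open>The correspondence is cut out by three homogenised equations: the one that removes infinity, the
  differential equation, and \<open>t e(x) = 1\<close>. Once infinity is removed, superfluous powers of the
  denominator \<open>b\<close> do no harm, which allows a uniform choice of exponents for all \<open>n\<close>.\<close>
lemma energy_correspondence:
  assumes F: "delta_subfield \<delta> F" and n: "n \<ge> 2"
  defines "X \<equiv> {x. \<delta> (\<delta> x) = x ^ n}"
  obtains Z where "closed_in_product \<delta> F 1 1 Z" "Z \<subseteq> affine_point ` X \<times> proj_space 1"
    "\<And>a t. a \<in> X \<Longrightarrow> (affine_point a, affine_point t) \<in> Z \<longleftrightarrow>
       t * (of_nat (n + 1) * (\<delta> a)\<^sup>2 - 2 * a ^ (n + 1)) = 1"
proof -
  let ?I = "Inl ` {..1::nat} \<union> Inr ` {..1::nat}"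
  have idx: "Inl 0 \<in> ?I" "Inl 1 \<in> ?I" "Inr 0 \<in> ?I" "Inr 1 \<in> ?I" by auto
  obtain Q d where "\<forall>c a b. Q (c * a) (c * b) = c ^ d * Q a b"
      and Q_dpoly: "dpoly_fun \<delta> F ?I (\<lambda>x. Q (x (Inl 0)) (x (Inl 1)))"
      and "\<forall>a. \<delta> (\<delta> a) = a ^ n \<longrightarrow> Q a 1 = 0" "\<forall>a. a \<noteq> 0 \<longrightarrow> Q a 0 \<noteq> 0"
    by (rule ex_hom_dpoly_separating_infinity[OF F n idx(1,2)], rule that)
  then have Q: "Q (c * a) (c * b) = c ^ d * Q a b"
    and Q_solution: "\<delta> (\<delta> a) = a ^ n \<Longrightarrow> Q a 1 = 0"
    and Q_infinity: "a \<noteq> 0 \<Longrightarrow> Q a 0 \<noteq> 0" for c a b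
    by auto
  define H where "H a b = b ^ n * hom_second a b - a ^ n * b ^ 3" for a b
  define A where
    "A a b = of_nat (n + 1) * b ^ (n + 1) * (wronskian a b)\<^sup>2 - 2 * b ^ 4 * a ^ (n + 1)" for a b
  have H: "H (c * a) (c * b) = c ^ (n + 3) * H a b" for c a b
    unfolding H_def hom_second_scale
    by (simp add: power_add power_mult_distrib algebra_simps)
  have A: "A (c * a) (c * b) = c ^ (n + 5) * A a b" for c a b
    unfolding A_def wronskian_scale
    by (simp add: power_add power_mult_distrib eval_nat_numeral algebra_simps)
  define \<Psi> :: "((nat + nat \<Rightarrow> 'u) \<Rightarrow> 'u) set" where
    "\<Psi> = {\<lambda>x. Q (x (Inl 0)) (x (Inl 1)), \<lambda>x. H (x (Inl 0)) (x (Inl 1)),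
      \<lambda>x. x (Inr 0) * A (x (Inl 0)) (x (Inl 1)) - x (Inr 1) * x (Inl 1) ^ (n + 5)}"
  define Z where "Z = {(p, q) \<in> proj_space 1 \<times> proj_space 1.
      \<forall>x\<in>p. \<forall>y\<in>q. \<forall>\<psi>\<in>\<Psi>. \<psi> (case_sum x y) = 0}"
  have mem_Z: "(p, q) \<in> Z \<longleftrightarrow> p \<in> proj_space 1 \<and> q \<in> proj_space 1 \<and>
      (\<forall>x\<in>p. \<forall>y\<in>q. Q (x 0) (x 1) = 0 \<and> H (x 0) (x 1) = 0 \<and>
        y 0 * A (x 0) (x 1) = y 1 * x 1 ^ (n + 5))" for p q
    by (simp add: Z_def \<Psi>_def)
  show thesis
  proof (rule that[of Z])
    have "bihomogeneous_dfun \<delta> F 1 1 (\<lambda>x. Q (x (Inl 0)) (x (Inl 1)))"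
      using Q_dpoly by (rule bihomogeneous_dfunI[where d = d and e = 0]) (auto simp: Q)
    moreover have "bihomogeneous_dfun \<delta> F 1 1 (\<lambda>x. H (x (Inl 0)) (x (Inl 1)))"
    proof (rule bihomogeneous_dfunI[where d = "n + 3" and e = 0])
      show "dpoly_fun \<delta> F ?I (\<lambda>x. H (x (Inl 0)) (x (Inl 1)))"
        unfolding H_def by (intro dpoly_fun_intros[OF F] dpoly_fun_hom_second[OF F] idx)
    qed (auto simp: H)
    moreover have "bihomogeneous_dfun \<delta> F 1 1
        (\<lambda>x. x (Inr 0) * A (x (Inl 0)) (x (Inl 1)) - x (Inr 1) * x (Inl 1) ^ (n + 5))"
    proof (rule bihomogeneous_dfunI[where d = "n + 5" and e = 1])
      show "dpoly_fun \<delta> F ?I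
          (\<lambda>x. x (Inr 0) * A (x (Inl 0)) (x (Inl 1)) - x (Inr 1) * x (Inl 1) ^ (n + 5))"
        unfolding A_def by (intro dpoly_fun_intros[OF F] dpoly_fun_wronskian[OF F] idx)
    qed (auto simp: A power_mult_distrib algebra_simps)
    ultimately show "closed_in_product \<delta> F 1 1 Z"
      unfolding Z_def by (intro closed_in_product_zero_locus) (auto simp: \<Psi>_def)
  next
    show "Z \<subseteq> affine_point ` X \<times> proj_space 1"
    proof clarify
      fix p q assume "(p, q) \<in> Z"
      then have pq: "p \<in> proj_space 1" "q \<in> proj_space 1"
        and QH: "\<And>x y. x \<in> p \<Longrightarrow> y \<in> q \<Longrightarrow> Q (x 0) (x 1) = 0 \<and> H (x 0) (x 1) = 0"
        by (auto simp: mem_Z)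
      obtain y where "y \<in> q"
        using pq(2) by (auto simp: proj_space_def proj_point_def)
      from pq(1) show "p \<in> affine_point ` X \<and> q \<in> proj_space 1"
      proof (cases rule: proj_space_1_cases)
        case (affine a)
        let ?x = "\<lambda>i::nat. if i = 0 then 1 * a else if i = 1 then 1 else 0"
        have "?x \<in> p"
          unfolding affine mem_affine_point_iff by (intro exI[of _ 1]) simp
        from QH[OF this \<open>y \<in> q\<close>] have "H a 1 = 0" by simp
        then have "a \<in> X"
          by (simp add: X_def H_def hom_second_def wronskian_def derivation_simps[OF der])
        then show ?thesis using affine pq(2) by blast
      next
        case (infinity x)
        then show ?thesis using QH[OF _ \<open>y \<in> q\<close>] Q_infinity by metis
      qed
    qed
  next
    fix a t assume "a \<in> X"
    then have a: "\<delta> (\<delta> a) = a ^ n" by (simp add: X_def)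
    have "Q a 1 = 0" using Q_solution[OF a] .
    moreover have "H a 1 = 0"
      by (simp add: H_def hom_second_def wronskian_def derivation_simps[OF der] a)
    moreover have "A a 1 = of_nat (n + 1) * (\<delta> a)\<^sup>2 - 2 * a ^ (n + 1)"
      by (simp add: A_def wronskian_def derivation_simps[OF der])
    ultimately have vals: "Q (c * a) c = 0" "H (c * a) c = 0"
        "A (c * a) c = c ^ (n + 5) * (of_nat (n + 1) * (\<delta> a)\<^sup>2 - 2 * a ^ (n + 1))" for c
      using Q[of c a 1] H[of c a 1] A[of c a 1] by simp_all
    let ?e = "of_nat (n + 1) * (\<delta> a)\<^sup>2 - 2 * a ^ (n + 1)"
    have "(affine_point a, affine_point t) \<in> Z \<longleftrightarrow>
        (\<forall>c. c \<noteq> 0 \<longrightarrow> (\<forall>e. e \<noteq> 0 \<longrightarrow> e * t * A (c * a) c = e * c ^ (n + 5)))"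
      unfolding mem_Z ball_affine_point_iff
      using affine_point_in_proj_space[of a] affine_point_in_proj_space[of t]
      by (simp add: vals(1,2))
    also have "\<dots> \<longleftrightarrow> t * ?e = 1"
    proof -
      have cancel: "k * u = k \<longleftrightarrow> u = 1" if "k \<noteq> 0" for k u :: 'u
        using that by simp
      have eq: "e * t * A (c * a) c = e * c ^ (n + 5) \<longleftrightarrow> t * ?e = 1"
        if "c \<noteq> 0" "e \<noteq> 0" for c e
      proof -
        have "e * t * A (c * a) c = e * c ^ (n + 5) * (t * ?e)"
          unfolding vals(3) by (simp only: ac_simps)
        moreover have "e * c ^ (n + 5) \<noteq> 0"
          using that by simp
        ultimately show ?thesis
          using cancel by presburger
      qed
      show ?thesis
      proof
        assume "\<forall>c. c \<noteq> 0 \<longrightarrow> (\<forall>e. e \<noteq> 0 \<longrightarrow> e * t * A (c * a) c = e * c ^ (n + 5))"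
        from this[rule_format, of 1 1] show "t * ?e = 1"
          using eq[of 1 1] by (simp only: one_neq_zero not_False_eq_True simp_thms)
      qed (use eq in blast)
    qed
    finally show "(affine_point a, affine_point t) \<in> Z \<longleftrightarrow> t * ?e = 1" .
  qed
qed

end

theorem proposition5p1:
  fixes \<delta> :: "'u::field_char_0 \<Rightarrow> 'u" and F :: "'u set" and n :: nat
  assumes "derivation \<delta>"
    and "model_DCF0 \<delta> UNIV" and "saturated \<delta>"
    and "model_DCF0 \<delta> F" and "fewer_than_universe F"
    and "n \<ge> 2"
  shows "\<not> delta_complete \<delta> F 1 (projective_closure \<delta> F {x. \<delta> (\<delta> x) = x ^ n})"
proof
  assume complete: "delta_complete \<delta> F 1 (projective_closure \<delta> F {x. \<delta> (\<delta> x) = x ^ n})"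
  let ?X = "{x. \<delta> (\<delta> x) = x ^ n}"
  note der = \<open>derivation \<delta>\<close>
  have F: "delta_subfield \<delta> F" and closed: "differentially_closed \<delta> UNIV"
    using assms by (simp_all add: model_DCF0_def)
  obtain Z where Z: "closed_in_product \<delta> F 1 1 Z" "Z \<subseteq> affine_point ` ?X \<times> proj_space 1"
    "\<And>a t. a \<in> ?X \<Longrightarrow> (affine_point a, affine_point t) \<in> Z \<longleftrightarrow>
       t * (of_nat (n + 1) * (\<delta> a)\<^sup>2 - 2 * a ^ (n + 1)) = 1"
    using energy_correspondence[OF der F \<open>n \<ge> 2\<close>] by blast
  have "Z \<subseteq> projective_closure \<delta> F ?X \<times> proj_space 1"
    using Z(2) affine_point_subset_closure[of ?X \<delta> F] by blast
  with complete Z(1) have "proj_variety \<delta> F 1 (snd ` Z)"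
    unfolding delta_complete_def using proj_variety_proj_space by blast
  then obtain S :: "(nat, 'u) dpoly set"
    where S: "snd ` Z = {p \<in> proj_space 1. \<forall>x\<in>p. \<forall>g\<in>S. deval \<delta> g x = 0}"
    unfolding proj_variety_def by blast
  have image: "affine_point (of_nat (Suc j)) \<in> snd ` Z" for j
  proof -
    let ?t = "of_nat (Suc j) :: 'u"
    have "?t \<noteq> 0" by (simp only: of_nat_eq_0_iff)
    then obtain x where "x \<in> ?X" "?t * (of_nat (n + 1) * (\<delta> x)\<^sup>2 - 2 * x ^ (n + 1)) = 1"
      using ex_solution_with_energy[OF der closed _ derivation_of_nat[OF der]] by blast
    with Z(3)[of x ?t] have "(affine_point x, affine_point ?t) \<in> Z" by blast
    then show ?thesis by (force intro: image_eqI[where f = snd])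
  qed
  have "deval \<delta> g y = 0" if "g \<in> S" and y0: "y \<in> affine_point 0" for g y
  proof -
    obtain c where c: "c \<noteq> 0" and "y = (\<lambda>i. if i = 0 then c * 0 else if i = 1 then c else 0)"
      using y0 unfolding mem_affine_point_iff by blast
    then have y: "y = (\<lambda>i. if i = 0 then 0 else if i = 1 then c else 0)"
      by auto
    have "deval \<delta> g (\<lambda>i. if i = 0 then c * of_nat (Suc j) else if i = 1 then c else 0) = 0" for j
    proof -
      have "(\<lambda>i. if i = 0 then c * of_nat (Suc j) else if i = 1 then c else 0)
          \<in> affine_point (of_nat (Suc j))"
        unfolding mem_affine_point_iff using c by blast
      then show ?thesis using image[of j] \<open>g \<in> S\<close> unfolding S by blast
    qed
    from deval_vanishes_at_limit_of_constants[OF der this] show ?thesis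
      by (simp add: y)
  qed
  then have "affine_point 0 \<in> snd ` Z"
    unfolding S using affine_point_in_proj_space by blast
  then obtain p where "(p, affine_point 0) \<in> Z" by auto
  moreover from this obtain a where "a \<in> ?X" "p = affine_point a"
    using Z(2) by blast
  ultimately show False
    using Z(3)[of a 0] by simp
qed

end
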